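(* Let $n\ge 5$ be an odd integer and $R_n^3=\langle (n-1)^3,n^3,(n+1)^3\rangle$. The matrix of minimal relations $\mathcal{A}$ of $R_n^3$ (with respect to $d_1=(n-1)^3$, $d_2=n^3$, $d_3=(n+1)^3$), its genus $G$ and its Frobenius number $F$ are as follows. (1) $n=18m+1$, $m\ge 1$: $$\mathcal{A}=\begin{pmatrix}216m^2+29m+1&-(216m^2-8m)&-m\\-(216m^2+2m-1)&216m^2-8m+8&-(26m+1)\\-(27m+2)&-8&27m+1\end{pmatrix},$$ $G=629856m^5+160380m^4+23220m^3+2330m^2+73m$; $F=1259712m^5+320760m^4+44712m^3+4644m^2+154m-1$. (2) $n=18m+3$, $m\ge 1$: $$\mathcal{A}=\begin{pmatrix}216m^2+83m+8&-(216m^2+40m)&-(7m+1)\\-(216m^2+56m+3)&216m^2+40m+8&-(20m+3)\\-(27m+5)&-8&27m+4\end{pmatrix},$$ $G=629856m^5+510300m^4+172260m^3+30134m^2+2657m+91$; $F=1259712m^5+1020600m^4+332424m^3+55404m^2+4698m+157$. (3) $n=18m+5$, $m\ge 0$: $$\mathcal{A}=\begin{pmatrix}216m^2+128m+19&-(216m^2+88m+8)&-(4m+1)\\-(216m^2+101m+11)&216m^2+88m+16&-(23m+6)\\-(27m+8)&-8&27m+7\end{pmatrix},$$ $G=629856m^5+860220m^4+476820m^3+134186m^2+18993m+1066$; $F=1259712m^5+1720440m^4+946728m^3+263412m^2+37082m+2107$. (4) $n=18m+7$, $m\ge 0$: $$\mathcal{A}=\begin{pmatrix}216m^2+191m+42&-(216m^2+136m+16)&-(19m+7)\\-(216m^2+164m+31)&216m^2+136m+24&-(8m+3)\\-(27m+11)&-8&27m+10\end{pmatrix},$$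 $G=629856m^5+1210140m^4+936900m^3+365246m^2+71609m+5637$; $F=10745$ if $m=0$; $F=1259712m^5+2420280m^4+1840968m^3+693468m^2+129322m+9537$ if $m\ge 1$. (5) $n=18m+9$, $m\ge 0$: $$\mathcal{A}=\begin{pmatrix}216m^2+245m+69&-(216m^2+184m+32)&-(25m+12)\\-(216m^2+218m+55)&216m^2+184m+40&-(2m+1)\\-(27m+14)&-8&27m+13\end{pmatrix},$$ $G=629856m^5+1560060m^4+1552500m^3+776234m^2+195001m+19684$; $F=1259712m^5+3108456m^4+3083184m^3+1537596m^2+385666m+38919$ if $m\le 3$; $F=1259712m^5+3120120m^4+3061800m^3+1488132m^2+358074m+34087$ if $m\ge 4$. (6) $n=18m+11$, $m\ge 0$: $$\mathcal{A}=\begin{pmatrix}216m^2+290m+97&-(216m^2+232m+56)&-(22m+13)\\-(216m^2+263m+80)&216m^2+232m+64&-(5m+3)\\-(27m+17)&-8&27m+16\end{pmatrix},$$ $G=629856m^5+1909980m^4+2323620m^3+1417694m^2+433745m+53223$; $F=103589$ if $m=0$; $F=1259712m^5+3819960m^4+4609224m^3+2766636m^2+826058m+98125$ if $m\ge 1$. (7) $n=18m+13$, $m\ge 0$: $$\mathcal{A}=\begin{pmatrix}216m^2+326m+123&-(216m^2+280m+88)&-(10m+7)\\-(216m^2+299m+103)&216m^2+280m+96&-(17m+12)\\-(27m+20)&-8&27m+19\end{pmatrix},$$ $G=629856m^5+2259900m^4+3250260m^3+2342114m^2+845465m+122286$; $F=1259712m^5+3120120m^4+3061800m^3+1488132m^2+358074m+34087$.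 (8) $n=18m+15$, $m\ge 0$: $$\mathcal{A}=\begin{pmatrix}216m^2+380m+167&-(216m^2+328m+120)&-(16m+13)\\-(216m^2+353m+144)&216m^2+328m+128&-(11m+9)\\-(27m+23)&-8&27m+22\end{pmatrix},$$ $G=629856m^5+2609820m^4+4332420m^3+3601550m^2+1499153m+249937$; $F=1259712m^5+5219640m^4+8637192m^3+7135452m^2+2943162m+484897$. (9) $n=18m+17$, $m\ge 0$: $$\mathcal{A}=\begin{pmatrix}216m^2+425m+209&-(216m^2+376m+160)&-(13m+12)\\-(216m^2+398m+183)&216m^2+376m+168&-(14m+13)\\-(27m+26)&-8&27m+25\end{pmatrix},$$ $G=629856m^5+2959740m^4+5570100m^3+5247626m^2+2474713m+467304$; $F=1259712m^5+5919480m^4+11117736m^3+10433124m^2+4892186m+917039$.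
   Context: For positive integers $d_1,d_2,d_3$ with $\gcd(d_1,d_2,d_3)=1$, $S=\langle d_1,d_2,d_3\rangle=\{x_1d_1+x_2d_2+x_3d_3 : x_i\in\mathbb{Z}_{\ge 0}\}$ is the numerical semigroup they generate. The Frobenius number $F(S)$ is the largest integer not in $S$; the genus $G(S)$ is the number of non-negative integers not in $S$. For a nonsymmetric $S=\langle d_1,d_2,d_3\rangle$, the matrix of minimal relations is the integer matrix $$\mathcal{A}=\begin{pmatrix}a_{11}&-a_{12}&-a_{13}\\-a_{21}&a_{22}&-a_{23}\\-a_{31}&-a_{32}&a_{33}\end{pmatrix},\qquad a_{ij}\in\mathbb{Z}_{\ge 0},$$ such that $\mathcal{A}(d_1,d_2,d_3)^{T}=0$, the greatest common divisor of the entries of each row is $1$, and for each $i$, with $\{i,j,k\}=\{1,2,3\}$, $a_{ii}=\min\{v\ge 2 : v\,d_i=v_jd_j+v_kd_k \text{ for some } v_j,v_k\in\mathbb{Z}_{\ge 0}\}$. (For nonsymmetric $S$ it is unique.) $S$ is symmetric if for every integer $s$ exactly one of $s,F(S)-s$ lies in $S$; the semigroups $R_n^3$ with $n\ge 4$ are nonsymmetric.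
   Formalization: Two misprints are corrected: in (3) the genus ends in 19121m+1098 instead of 18993m+1066, and in (7) F=1259712m^5+4519800m^4+6483240m^3+4648212m^2+1665946m+238803 instead of the polynomial repeated from (5); the printed formulas fail for every m. *)

theory Defs
  imports "HOL-Analysis.Analysis"
begin

definition gen_semigroup :: "int ^ 3 \<Rightarrow> int set" where
  "gen_semigroup d = {\<Sum>j\<in>UNIV. int (x j) * d $ j | x :: 3 \<Rightarrow> nat. True}"

(* GREATEST rather than Max: the complement of S in the integers is infinite
   (it contains all negative integers). *)
definition frobenius_number :: "int set \<Rightarrow> int" where
  "frobenius_number S = (GREATEST s. s \<notin> S)"

definition genus :: "int set \<Rightarrow> nat" where
  "genus S = card {s. 0 \<le> s \<and> s \<notin> S}"

definition relation_multiples :: "int ^ 3 \<Rightarrow> 3 \<Rightarrow> int set" where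
  "relation_multiples d i =
     {v. 2 \<le> v \<and> (\<exists>c :: 3 \<Rightarrow> nat. v * d $ i = (\<Sum>j\<in>UNIV - {i}. int (c j) * d $ j))}"

(* The matrix entries carry their signs: A $ i $ j is a_ii for i = j and - a_ij otherwise,
   with all a_ij non-negative. The last two conjuncts say a_ii = min (relation_multiples d i). *)
definition minimal_relations_matrix :: "int ^ 3 \<Rightarrow> int ^ 3 ^ 3 \<Rightarrow> bool" where
  "minimal_relations_matrix d A \<longleftrightarrow>
     A *v d = 0 \<and>
     (\<forall>i. 0 \<le> A $ i $ i) \<and>
     (\<forall>i j. i \<noteq> j \<longrightarrow> A $ i $ j \<le> 0) \<and>
     (\<forall>i. (GCD j\<in>UNIV. A $ i $ j) = 1) \<and>
     (\<forall>i. A $ i $ i \<in> relation_multiples d i) \<and>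
     (\<forall>i. \<forall>v\<in>relation_multiples d i. A $ i $ i \<le> v)"

definition cube_generators :: "int \<Rightarrow> int ^ 3" where
  "cube_generators n = vector [(n - 1) ^ 3, n ^ 3, (n + 1) ^ 3]"

(* "The matrix of minimal relations is A": the equivalence includes uniqueness. *)
definition the_minimal_relations_matrix_is :: "int ^ 3 \<Rightarrow> int ^ 3 ^ 3 \<Rightarrow> bool" where
  "the_minimal_relations_matrix_is d A \<longleftrightarrow>
     (\<forall>B. minimal_relations_matrix d B \<longleftrightarrow> B = A)"

end

(* Let u1 d1 = r12 d2 + r13 d3 and its two companions be relations whose coefficients satisfy the
   column-sum and minor identities of a Herzog matrix. They rewrite every integer combination
   x d1 + y d2 + z d3 to one with (y, z) in an L-shaped set of exactly d1 lattice points. Since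
   gcd(d1, d2, d3) = 1, these points represent each residue modulo d1 exactly once, so every integer
   has a unique such normal form and lies in the semigroup iff x >= 0. The two outer corners of the
   L give the Frobenius number, summation over it gives the genus
   (2 G = 1 + sum (u_i - 1) d_i - u1 u2 u3), and uniqueness of the normal form, after cyclic rotation,
   gives minimality and uniqueness of the relations. For cubes all hypotheses are polynomial
   identities in m; which corner wins depends on the sign of 8 n^3 - r23 (n + 1)^3. *)

theory Submission
  imports Defs
begin

section \<open>Interval sums, and relation matrices with the generators they determine\<close>

lemma double_sum_int_interval:
  fixes p q :: int
  assumes "p \<le> q"
  shows "2 * (\<Sum>j\<in>{p..<q}. j) = (q - p) * (q + p - 1)"
  using assms
proof (induction q rule: int_ge_induct)
  case base
  then show ?case by simp
next
  case (step q)
  have "{p..<q + 1} = insert q {p..<q}" using step.hyps by auto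
  then show ?case using step.IH by (simp add: algebra_simps)
qed

text \<open>The numbers \<open>a\<close>, \<open>b\<close>, \<open>c\<close> are the diagonal
  cofactors of the matrix with rows \<open>(u1, -r12, -r13)\<close>,
  \<open>(-r21, u2, -r23)\<close>, \<open>(-r31, -r32, u3)\<close>, whose columns sum to zero.
  Nothing is assumed about minimality of the rows; that is derived.\<close>

locale three_relations =
  fixes a b c u1 u2 u3 r12 r13 r21 r23 r31 r32 :: int
  assumes pos: "0 < r12" "0 < r13" "0 < r21" "0 < r23" "0 < r31" "0 < r32"
    and column_sums: "u1 = r21 + r31" "u2 = r12 + r32" "u3 = r13 + r23"
    and minors: "a = u2 * u3 - r23 * r32" "b = u1 * u3 - r13 * r31" "c = u1 * u2 - r12 * r21"
    and gcd_one: "gcd a (gcd b c) = 1"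
begin

text \<open>The hypotheses are invariant under a cyclic shift of the generators, so what is proved
  for the second row transfers to the other two.\<close>

lemma rotate: "three_relations b c a u2 u3 u1 r23 r21 r32 r31 r12 r13"
  using pos gcd_one
  by unfold_locales (auto simp: minors column_sums algebra_simps gcd.commute gcd.left_commute)

lemma sizes: "r21 < u1" "r31 < u1" "r12 < u2" "r32 < u2" "r13 < u3" "r23 < u3"
  using pos column_sums by auto

text \<open>Vanishing column sums make every column of the adjugate equal to
  \<open>(a, b, c)\<close>, and the determinant zero. Hence the matrix annihilates this
  vector.\<close>

lemma relation1: "u1 * a = r12 * b + r13 * c"
  and relation2: "u2 * b = r21 * a + r23 * c"
  and relation3: "u3 * c = r31 * a + r32 * b"
  unfolding minors column_sums by (simp_all add: algebra_simps)

lemma generators_pos: "0 < a" "0 < b" "0 < c"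
proof -
  have "a = r12 * r13 + r12 * r23 + r32 * r13" "b = r21 * r13 + r21 * r23 + r31 * r23"
    "c = r21 * r32 + r31 * r12 + r31 * r32"
    unfolding minors column_sums by (simp_all add: algebra_simps)
  then show "0 < a" "0 < b" "0 < c" using pos by (auto intro!: add_pos_pos)
qed

section \<open>Normal forms over the L-shaped set\<close>

definition S :: "int set" where
  "S = {x * a + y * b + z * c | x y z. 0 \<le> x \<and> 0 \<le> y \<and> 0 \<le> z}"

text \<open>These pairs are the exponents of the monomials divisible by none of \<open>Y^u2\<close>,
  \<open>Z^u3\<close>, \<open>Y^r12 Z^r13\<close>, the leading terms of the three relations. The
  values \<open>y * b + z * c\<close> on \<open>L\<close> form the Apery set of \<open>S\<close>
  with respect to \<open>a\<close>.\<close>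

definition L :: "(int \<times> int) set" where
  "L = {0..<u2} \<times> {0..<u3} - {r12..<u2} \<times> {r13..<u3}"

lemma mem_L_iff:
  "(y, z) \<in> L \<longleftrightarrow> 0 \<le> y \<and> y < u2 \<and> 0 \<le> z \<and> z < u3 \<and> (y < r12 \<or> z < r13)"
  unfolding L_def by auto

lemma finite_L: "finite L"
  unfolding L_def by simp

text \<open>Each of the three relations, applied to a pair outside \<open>L\<close>, trades copies of \<open>b\<close> and \<open>c\<close>
  for copies of \<open>a\<close>, so rewriting terminates.\<close>

lemma reduce_to_L:
  assumes "0 \<le> y" "0 \<le> z"
  shows "\<exists>x' y' z'. (y', z') \<in> L \<and> x \<le> x' \<and> x * a + y * b + z * c = x' * a + y' * b + z' * c \<and>
    ((y, z) \<notin> L \<longrightarrow> x < x')"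
  using assms
proof (induction "nat (y * b + z * c)" arbitrary: x y z rule: less_induct)
  case less
  show ?case
  proof (cases "(y, z) \<in> L")
    case True
    then show ?thesis by blast
  next
    case False
    have step: ?thesis if "0 \<le> y1" "0 \<le> z1" "x < x1"
      and eq: "x1 * a + y1 * b + z1 * c = x * a + y * b + z * c" for x1 y1 z1
    proof -
      have "x * a < x1 * a" using that generators_pos by simp
      then have lt: "y1 * b + z1 * c < y * b + z * c" using eq by linarith
      have "0 \<le> y1 * b + z1 * c" using that generators_pos by simp
      then have "nat (y1 * b + z1 * c) < nat (y * b + z * c)" using lt by simp
      from less.hyps[OF this that(1,2), of x1] show ?thesis
        using \<open>x < x1\<close> unfolding eq by (meson order.strict_trans2 order.strict_implies_order)
    qed
    consider "u2 \<le> y" | "u3 \<le> z" | "r12 \<le> y" "r13 \<le> z"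
      using False less.prems unfolding mem_L_iff by linarith
    then show ?thesis
    proof cases
      case 1
      show ?thesis
        by (rule step[of "y - u2" "z + r23" "x + r21"])
           (use 1 less.prems pos relation2 in \<open>auto simp: algebra_simps\<close>)
    next
      case 2
      show ?thesis
        by (rule step[of "y + r32" "z - u3" "x + r31"])
           (use 2 less.prems pos relation3 in \<open>auto simp: algebra_simps\<close>)
    next
      case 3
      show ?thesis
        by (rule step[of "y - r12" "z - r13" "x + u1"])
           (use 3 less.prems pos relation1 column_sums in \<open>auto simp: algebra_simps\<close>)
    qed
  qed
qed

lemma representation:
  obtains x y z where "(y, z) \<in> L" "s = x * a + y * b + z * c"
proof -
  obtain g h where "gcd b c = g * b + h * c"
    using bezout_int[of b c] by metis
  moreover obtain p q where "gcd a (gcd b c) = p * a + q * gcd b c"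
    using bezout_int[of a "gcd b c"] by metis
  ultimately have one: "1 = p * a + (q * g) * b + (q * h) * c"
    using gcd_one by (simp add: algebra_simps)
  define Y Z where "Y = s * (q * g)" and "Z = s * (q * h)"
  have "s = s * (p * a + (q * g) * b + (q * h) * c)"
    unfolding one[symmetric] by simp
  then have s: "s = (s * p) * a + Y * b + Z * c"
    by (simp add: Y_def Z_def algebra_simps)
  \<comment> \<open>Bezout coefficients may be negative, while \<open>reduce_to_L\<close> needs
    non-negative ones. So they are reduced modulo \<open>a\<close>, and the coefficient of
    \<open>a\<close>, whose sign is free, absorbs the quotients.\<close>
  have "Y * b = (Y div a * b) * a + (Y mod a) * b" "Z * c = (Z div a * c) * a + (Z mod a) * c"
    by (metis div_mult_mod_eq distrib_right mult.assoc mult.commute)+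
  then have s': "s = (s * p + Y div a * b + Z div a * c) * a + (Y mod a) * b + (Z mod a) * c"
    using s by (simp add: algebra_simps)
  have "0 \<le> Y mod a" "0 \<le> Z mod a" using generators_pos by auto
  from reduce_to_L[OF this, of "s * p + Y div a * b + Z div a * c"] show ?thesis
    using that s' by metis
qed

text \<open>The removed corner has sides \<open>u2 - r12 = r32\<close> and
  \<open>u3 - r13 = r23\<close>, so the count is the minor that defines \<open>a\<close>.\<close>

lemma card_L: "int (card L) = a"
proof -
  have "card L = card ({0..<u2} \<times> {0..<u3}) - card ({r12..<u2} \<times> {r13..<u3})"
    unfolding L_def using pos by (intro card_Diff_subset) auto
  also have "\<dots> = nat u2 * nat u3 - nat r32 * nat r23"
    using column_sums by (simp add: card_cartesian_product)
  finally have *: "card L = nat u2 * nat u3 - nat r32 * nat r23" .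
  \<comment> \<open>This keeps the truncated subtraction on natural numbers exact.\<close>
  have "nat r32 * nat r23 \<le> nat u2 * nat u3"
    by (rule mult_mono) (use pos column_sums in auto)
  then show ?thesis
    using pos column_sums unfolding * minors by (simp add: of_nat_diff)
qed

lemma bij_betw_L_residues: "bij_betw (\<lambda>(y, z). (y * b + z * c) mod a) L {0..<a}"
proof -
  let ?f = "\<lambda>(y, z). (y * b + z * c) mod a"
  have img: "?f ` L = {0..<a}"
  proof
    show "?f ` L \<subseteq> {0..<a}" using generators_pos by auto
    show "{0..<a} \<subseteq> ?f ` L"
    proof
      fix s assume s: "s \<in> {0..<a}"
      obtain x y z where "(y, z) \<in> L" "s = x * a + y * b + z * c" by (rule representation)
      moreover from this have "s = (y * b + z * c) mod a"
        using s by (metis add.assoc add.commute atLeastLessThan_iff mod_mult_self1 mod_pos_pos_trivial)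
      ultimately show "s \<in> ?f ` L" by force
    qed
  qed
  \<comment> \<open>\<open>L\<close> meets every residue class and has only \<open>a\<close> elements.\<close>
  moreover have "inj_on ?f L"
    by (rule eq_card_imp_inj_on[OF finite_L]) (use img card_L in simp)
  ultimately show ?thesis by (simp add: bij_betw_def)
qed

text \<open>Modulo \<open>a\<close> the first coefficient disappears, and injectivity on
  \<open>L\<close> identifies the other two.\<close>

lemma representation_unique:
  assumes "(y, z) \<in> L" "(y', z') \<in> L" and eq: "x * a + y * b + z * c = x' * a + y' * b + z' * c"
  shows "x = x' \<and> y = y' \<and> z = z'"
proof -
  have "y * b + z * c = (y' * b + z' * c) + (x' - x) * a" using eq by (simp add: algebra_simps)
  then have "(y * b + z * c) mod a = (y' * b + z' * c) mod a" by simp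
  then have "(y, z) = (y', z')"
    using bij_betw_L_residues assms(1,2) unfolding bij_betw_def inj_on_def by fastforce
  then show ?thesis using eq generators_pos by simp
qed

text \<open>Rewriting a non-negative representation into \<open>L\<close> never lowers the
  coefficient of \<open>a\<close>, so the unique normal form of a member of \<open>S\<close> has
  \<open>0 \<le> x\<close>.\<close>

lemma mem_S_iff:
  assumes "(y, z) \<in> L"
  shows "x * a + y * b + z * c \<in> S \<longleftrightarrow> 0 \<le> x"
proof
  assume "x * a + y * b + z * c \<in> S"
  then obtain x1 y1 z1 where 1: "x * a + y * b + z * c = x1 * a + y1 * b + z1 * c"
    "0 \<le> x1" "0 \<le> y1" "0 \<le> z1" unfolding S_def by auto
  obtain x2 y2 z2 where "(y2, z2) \<in> L" "x1 \<le> x2"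
    "x1 * a + y1 * b + z1 * c = x2 * a + y2 * b + z2 * c"
    using reduce_to_L[OF 1(3,4), of x1] by blast
  then show "0 \<le> x" using representation_unique[OF assms, of y2 z2 x x2] 1 by auto
next
  assume "0 \<le> x"
  then show "x * a + y * b + z * c \<in> S" unfolding S_def using assms mem_L_iff by blast
qed

section \<open>The Frobenius number\<close>

lemma frobenius_S:
  "frobenius_number S = max ((u2 - 1) * b + (r13 - 1) * c) ((r12 - 1) * b + (u3 - 1) * c) - a"
    (is "_ = max ?p ?q - a")
  unfolding frobenius_number_def
proof (rule Greatest_equality)
  \<comment> \<open>Both corners of \<open>L\<close> are taken with \<open>x = -1\<close>, the
    largest coefficient of a non-member.\<close>
  have "?p - a \<notin> S"
    using mem_S_iff[of "u2 - 1" "r13 - 1" "-1"] pos sizes by (simp add: mem_L_iff algebra_simps)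
  moreover have "?q - a \<notin> S"
    using mem_S_iff[of "r12 - 1" "u3 - 1" "-1"] pos sizes by (simp add: mem_L_iff algebra_simps)
  ultimately show "max ?p ?q - a \<notin> S" by (simp add: max_def)
next
  fix s assume "s \<notin> S"
  obtain x y z where L: "(y, z) \<in> L" and s: "s = x * a + y * b + z * c" by (rule representation)
  have "x \<le> -1" using \<open>s \<notin> S\<close> mem_S_iff[OF L] s by fastforce
  then have "x * a \<le> -1 * a" using generators_pos by (intro mult_right_mono) auto
  moreover have "y * b + z * c \<le> max ?p ?q"
  proof -
    have mono: "y * b + z * c \<le> y' * b + z' * c" if "y \<le> y'" "z \<le> z'" for y' z'
      using that generators_pos by (intro add_mono mult_right_mono) auto
    \<comment> \<open>Every point of \<open>L\<close> lies below one of its two outer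
      corners.\<close>
    from L have "y \<le> r12 - 1 \<and> z \<le> u3 - 1 \<or> y \<le> u2 - 1 \<and> z \<le> r13 - 1"
      unfolding mem_L_iff by linarith
    then show ?thesis using mono by (meson max.coboundedI1 max.coboundedI2)
  qed
  ultimately show "s \<le> max ?p ?q - a" unfolding s by linarith
qed

text \<open>The two corner values differ by \<open>r23 * c - r32 * b\<close>, whose sign selects the
  maximum.\<close>

lemma frobenius_S_if_le:
  "r32 * b \<le> r23 * c \<Longrightarrow> frobenius_number S = (r12 - 1) * b + (u3 - 1) * c - a"
  "r23 * c \<le> r32 * b \<Longrightarrow> frobenius_number S = (u2 - 1) * b + (r13 - 1) * c - a"
  unfolding frobenius_S column_sums by (simp_all add: max_def algebra_simps)

section \<open>Counting the gaps: the genus\<close>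

lemma gaps_bij_betw:
  "bij_betw (\<lambda>((y, z), k). y * b + z * c - k * a) (SIGMA p : L. {1..(fst p * b + snd p * c) div a})
     {s. 0 \<le> s \<and> s \<notin> S}"
proof (rule bij_betw_imageI)
  show "inj_on (\<lambda>((y, z), k). y * b + z * c - k * a) (SIGMA p : L. {1..(fst p * b + snd p * c) div a})"
  proof (rule inj_onI)
    fix p q
    assume pq: "p \<in> (SIGMA p : L. {1..(fst p * b + snd p * c) div a})"
      "q \<in> (SIGMA p : L. {1..(fst p * b + snd p * c) div a})"
      "(\<lambda>((y, z), k). y * b + z * c - k * a) p = (\<lambda>((y, z), k). y * b + z * c - k * a) q"
    obtain y z k y' z' k' where "p = ((y, z), k)" "q = ((y', z'), k')"
      by (metis prod.exhaust)
    then show "p = q"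
      \<comment> \<open>The normal form of a gap has \<open>- k\<close> as its coefficient of
        \<open>a\<close>.\<close>
      using pq representation_unique[of y z y' z' "- k" "- k'"] by simp
  qed
  show "(\<lambda>((y, z), k). y * b + z * c - k * a) ` (SIGMA p : L. {1..(fst p * b + snd p * c) div a})
    = {s. 0 \<le> s \<and> s \<notin> S}"
  proof (intro equalityI subsetI)
    fix s assume "s \<in> (\<lambda>((y, z), k). y * b + z * c - k * a) ` (SIGMA p : L. {1..(fst p * b + snd p * c) div a})"
    then obtain y z k where L: "(y, z) \<in> L" and k: "1 \<le> k" "k \<le> (y * b + z * c) div a"
      and s: "s = (- k) * a + y * b + z * c" by auto
    have "k * a \<le> (y * b + z * c) div a * a"
      using k generators_pos by (intro mult_right_mono) auto
    also have "\<dots> \<le> y * b + z * c"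
      using generators_pos by (simp add: div_mult_mod_eq[symmetric] minus_mod_eq_div_mult[symmetric])
    finally show "s \<in> {s. 0 \<le> s \<and> s \<notin> S}"
      using mem_S_iff[OF L, of "-k"] k unfolding s by simp
  next
    fix s assume "s \<in> {s. 0 \<le> s \<and> s \<notin> S}"
    then have s: "0 \<le> s" "s \<notin> S" by auto
    obtain x y z where L: "(y, z) \<in> L" and eq: "s = x * a + y * b + z * c" by (rule representation)
    have "x \<le> -1" using \<open>s \<notin> S\<close> mem_S_iff[OF L] eq by fastforce
    \<comment> \<open>With \<open>k = - x\<close>, the condition \<open>0 \<le> s\<close> is the
      upper bound on \<open>k\<close>.\<close>
    moreover have "- x \<le> (y * b + z * c) div a"
    proof -
      have "(-x) * a div a \<le> (y * b + z * c) div a"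
        using s(1) generators_pos by (intro zdiv_mono1) (auto simp: eq)
      moreover have "(-x) * a div a = - x"
        using generators_pos by (intro nonzero_mult_div_cancel_right) simp
      ultimately show ?thesis by simp
    qed
    ultimately have "((y, z), -x) \<in> (SIGMA p : L. {1..(fst p * b + snd p * c) div a})"
      using L by simp
    then show "s \<in> (\<lambda>((y, z), k). y * b + z * c - k * a) ` (SIGMA p : L. {1..(fst p * b + snd p * c) div a})"
      by (rule rev_image_eqI) (simp add: eq)
  qed
qed

text \<open>A linear function summed over a rectangle splits into two arithmetic progressions, and
  \<open>L\<close> is a difference of two rectangles. Doubling avoids the halves in their
  sums.\<close>

lemma sum_L:
  "2 * (\<Sum>(y, z)\<in>L. y * b + z * c) =
     b * (u3 * u2 * (u2 - 1) - r23 * r32 * (u2 + r12 - 1)) +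
     c * (u2 * u3 * (u3 - 1) - r32 * r23 * (u3 + r13 - 1))"
proof -
  have rect: "2 * (\<Sum>(y, z)\<in>{p..<q} \<times> {p'..<q'}. y * b + z * c) =
      b * ((q' - p') * ((q - p) * (q + p - 1))) + c * ((q - p) * ((q' - p') * (q' + p' - 1)))"
    if "p \<le> q" "p' \<le> q'" for p q p' q' :: int
  proof -
    have "(\<Sum>(y, z)\<in>{p..<q} \<times> {p'..<q'}. y * b + z * c) =
        b * ((q' - p') * (\<Sum>j\<in>{p..<q}. j)) + c * ((q - p) * (\<Sum>j\<in>{p'..<q'}. j))"
      using that
      by (simp add: sum.cartesian_product[symmetric] sum.distrib sum_distrib_left sum_distrib_right
          ac_simps)
    then have "2 * (\<Sum>(y, z)\<in>{p..<q} \<times> {p'..<q'}. y * b + z * c) =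
        b * ((q' - p') * (2 * (\<Sum>j\<in>{p..<q}. j))) + c * ((q - p) * (2 * (\<Sum>j\<in>{p'..<q'}. j)))"
      by (simp only: algebra_simps)
    then show ?thesis using that by (simp only: double_sum_int_interval)
  qed
  have "(\<Sum>(y, z)\<in>L. y * b + z * c) = (\<Sum>(y, z)\<in>{0..<u2} \<times> {0..<u3}. y * b + z * c)
      - (\<Sum>(y, z)\<in>{r12..<u2} \<times> {r13..<u3}. y * b + z * c)"
    unfolding L_def using pos by (intro sum_diff) auto
  then show ?thesis
    using rect[of 0 u2 0 u3] rect[of r12 u2 r13 u3] pos column_sums
    by (simp add: algebra_simps)
qed

text \<open>The gaps in the residue class of \<open>w = y b + z c\<close> number \<open>w div a\<close>, while the remainders
  \<open>w mod a\<close> run through \<open>0, \<dots>, a - 1\<close> (Selmer's formula).\<close>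

lemma genus_S:
  "2 * int (genus S) = 1 + (u1 - 1) * a + (u2 - 1) * b + (u3 - 1) * c - u1 * u2 * u3"
proof -
  let ?w = "\<lambda>p. fst p * b + snd p * c"
  have w_nonneg: "0 \<le> ?w p" if "p \<in> L" for p
    using that generators_pos by (cases p) (auto simp: mem_L_iff)
  have "int (genus S) = int (card (SIGMA p : L. {1..?w p div a}))"
    unfolding genus_def using bij_betw_same_card[OF gaps_bij_betw] by simp
  also have "\<dots> = (\<Sum>p\<in>L. ?w p div a)"
    using finite_L w_nonneg generators_pos by (simp add: pos_imp_zdiv_nonneg_iff)
  finally have G: "int (genus S) = (\<Sum>p\<in>L. ?w p div a)" .
  have "(\<Sum>p\<in>L. ?w p) = (\<Sum>p\<in>L. a * (?w p div a) + ?w p mod a)"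
    by simp
  also have "\<dots> = a * int (genus S) + (\<Sum>p\<in>L. ?w p mod a)"
    by (simp only: sum.distrib sum_distrib_left G)
  also have "(\<Sum>p\<in>L. ?w p mod a) = (\<Sum>j\<in>{0..<a}. j)"
    using sum.reindex_bij_betw[OF bij_betw_L_residues, of "\<lambda>j. j"] by (simp add: case_prod_beta)
  finally have "2 * (\<Sum>p\<in>L. ?w p) = a * (2 * int (genus S)) + 2 * (\<Sum>j\<in>{0..<a}. j)" by simp
  then have "a * (2 * int (genus S)) =
      b * (u3 * u2 * (u2 - 1) - r23 * r32 * (u2 + r12 - 1)) +
      c * (u2 * u3 * (u3 - 1) - r32 * r23 * (u3 + r13 - 1)) - a * (a - 1)"
    using sum_L double_sum_int_interval[of 0 a] generators_pos
    by (simp add: case_prod_beta)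
  \<comment> \<open>After substitution of the minors and column sums both sides are polynomials in
    the six off-diagonal entries. The common factor \<open>a\<close> then cancels.\<close>
  also have "\<dots> = a * (1 + (u1 - 1) * a + (u2 - 1) * b + (u3 - 1) * c - u1 * u2 * u3)"
    unfolding minors column_sums by algebra
  finally show ?thesis using generators_pos by simp
qed

section \<open>Minimality and uniqueness of the relations\<close>

lemma relation2_minimal:
  assumes v: "1 \<le> v" and xz: "0 \<le> x" "0 \<le> z" and eq: "v * b = x * a + z * c"
  shows "u2 \<le> v"
proof (rule ccontr)
  assume "\<not> u2 \<le> v"
  \<comment> \<open>Below \<open>u2\<close>, the number \<open>v * b\<close> is its own normal form,
    with coefficient 0 of \<open>a\<close>.\<close>
  then have L: "(v, 0) \<in> L" using v pos sizes by (simp add: mem_L_iff)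
  obtain x' y' z' where 1: "(y', z') \<in> L" "x \<le> x'"
    "x * a + 0 * b + z * c = x' * a + y' * b + z' * c" "(0, z) \<notin> L \<longrightarrow> x < x'"
    using reduce_to_L[of 0 z x] xz by auto
  then have "0 = x'"
    using representation_unique[OF L 1(1), of 0 x'] eq by simp
  \<comment> \<open>Rewriting a pair outside \<open>L\<close> would raise the coefficient of
    \<open>a\<close> strictly, yet it ends at 0. So \<open>x * a + z * c\<close> was already in
    normal form.\<close>
  then have "(0, z) \<in> L" "x = 0" using 1 xz by auto
  then show False using representation_unique[OF L, of 0 z 0 x] eq v by simp
qed

lemma relation2_unique:
  assumes xz: "0 \<le> x" "0 \<le> z" and eq: "u2 * b = x * a + z * c"
  shows "x = r21 \<and> z = r23"
proof -
  have "z < u3"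
  proof (rule ccontr)
    assume "\<not> z < u3"
    \<comment> \<open>Replacing \<open>u3\<close> copies of \<open>c\<close> by
      \<open>relation3\<close> and cancelling \<open>r32 * b\<close> leaves a relation with the
      smaller multiplier \<open>u2 - r32 = r12\<close>.\<close>
    then have "u2 \<le> u2 - r32"
      using xz pos column_sums eq relation3
      by (intro relation2_minimal[of _ "x + r31" "z - u3"]) (auto simp: algebra_simps)
    then show False using pos by simp
  qed
  then have "(0, z) \<in> L" "(0, r23) \<in> L"
    using xz pos sizes by (auto simp: mem_L_iff)
  then show ?thesis
    using representation_unique[of 0 z 0 r23 x r21] eq relation2 by simp
qed

text \<open>A common factor \<open>g\<close> of the row could be cancelled from
  \<open>relation2\<close>, leaving the multiplier \<open>u2 / g\<close>, so minimality forces
  \<open>g = 1\<close>.\<close>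

lemma row2_coprime: "gcd r21 (gcd u2 r23) = 1"
proof -
  define g where "g = gcd r21 (gcd u2 r23)"
  have "g dvd r21" "g dvd u2" "g dvd r23"
    unfolding g_def by (blast intro: dvd_trans gcd_dvd1 gcd_dvd2)+
  then obtain x v z where d: "r21 = g * x" "u2 = g * v" "r23 = g * z" by (auto elim!: dvdE)
  have "0 < g" unfolding g_def using pos by simp
  have "0 < u2" using pos column_sums by simp
  have x: "0 < x" "0 < v" "0 < z"
    using d pos \<open>0 < g\<close> \<open>0 < u2\<close> by (auto simp: zero_less_mult_iff)
  have "g * (v * b) = g * (x * a + z * c)" using relation2 d by (simp add: algebra_simps)
  then have "v * b = x * a + z * c" using \<open>0 < g\<close> by simp
  then have "g * v \<le> 1 * v" using relation2_minimal[of v x z] x d by simp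
  then have "g = 1" using x \<open>0 < g\<close> by simp
  then show ?thesis unfolding g_def .
qed

text \<open>The second generator of \<open>rot\<close> is \<open>c\<close> and that of
  \<open>rot2\<close> is \<open>a\<close>, so their second rows are the third and first rows
  here.\<close>

interpretation rot: three_relations b c a u2 u3 u1 r23 r21 r32 r31 r12 r13
  by (rule rotate)

interpretation rot2: three_relations c a b u3 u1 u2 r31 r32 r13 r12 r23 r21
  by (rule rot.rotate)

section \<open>Passage to vectors and matrices\<close>

lemma S_eq_gen_semigroup: "gen_semigroup (vector [a, b, c]) = S"
proof
  show "gen_semigroup (vector [a, b, c]) \<subseteq> S"
    unfolding gen_semigroup_def S_def by (force simp: sum_3)
  show "S \<subseteq> gen_semigroup (vector [a, b, c])"
  proof
    fix s assume "s \<in> S"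
    then obtain x y z where s: "s = x * a + y * b + z * c" and nn: "0 \<le> x" "0 \<le> y" "0 \<le> z"
      unfolding S_def by auto
    let ?f = "\<lambda>j::3. if j = 1 then nat x else if j = 2 then nat y else nat z"
    have "s = (\<Sum>j\<in>UNIV. int (?f j) * vector [a, b, c] $ j)"
      using nn by (simp add: s sum_3)
    then show "s \<in> gen_semigroup (vector [a, b, c])"
      unfolding gen_semigroup_def by (intro CollectI exI[of _ ?f]) simp
  qed
qed

lemma relation_multiples_iff:
  "v \<in> relation_multiples (vector [a, b, c]) 1 \<longleftrightarrow>
     2 \<le> v \<and> (\<exists>y z. 0 \<le> y \<and> 0 \<le> z \<and> v * a = y * b + z * c)" (is ?one)
  "v \<in> relation_multiples (vector [a, b, c]) 2 \<longleftrightarrow>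
     2 \<le> v \<and> (\<exists>x z. 0 \<le> x \<and> 0 \<le> z \<and> v * b = x * a + z * c)" (is ?two)
  "v \<in> relation_multiples (vector [a, b, c]) 3 \<longleftrightarrow>
     2 \<le> v \<and> (\<exists>x y. 0 \<le> x \<and> 0 \<le> y \<and> v * c = x * a + y * b)" (is ?three)
proof -
  have compl: "UNIV - {1::3} = {2, 3}" "UNIV - {2::3} = {1, 3}" "UNIV - {3::3} = {1, 2}"
    unfolding UNIV_3 by auto
  \<comment> \<open>Only two values of the coefficient function enter the relation, so functions can
    be traded for pairs of non-negative integers.\<close>
  have coeffs: "(\<exists>f :: 3 \<Rightarrow> nat. P (int (f i)) (int (f j))) \<longleftrightarrow> (\<exists>x y. 0 \<le> x \<and> 0 \<le> y \<and> P x y)"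
    if "i \<noteq> j" for P i j
  proof safe
    fix x y :: int assume "0 \<le> x" "0 \<le> y" "P x y"
    then have "P (int (((\<lambda>_. 0)(i := nat x, j := nat y)) i)) (int (((\<lambda>_. 0)(i := nat x, j := nat y)) j))"
      using that by simp
    then show "\<exists>f :: 3 \<Rightarrow> nat. P (int (f i)) (int (f j))" by blast
  next
    fix f :: "3 \<Rightarrow> nat" assume "P (int (f i)) (int (f j))"
    then show "\<exists>x y. 0 \<le> x \<and> 0 \<le> y \<and> P x y" by (meson of_nat_0_le_iff)
  qed
  show ?one
    using coeffs[of 2 3 "\<lambda>y z. v * a = y * b + z * c"]
    by (simp add: relation_multiples_def compl)
  show ?two
    using coeffs[of 1 3 "\<lambda>x z. v * b = x * a + z * c"]
    by (simp add: relation_multiples_def compl)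
  show ?three
    using coeffs[of 1 2 "\<lambda>x y. v * c = x * a + y * b"]
    by (simp add: relation_multiples_def compl)
qed

lemma relation1_minimal: "\<lbrakk>1 \<le> v; 0 \<le> y; 0 \<le> z; v * a = y * b + z * c\<rbrakk> \<Longrightarrow> u1 \<le> v"
  using rot2.relation2_minimal[of v z y] by simp

lemma relation3_minimal: "\<lbrakk>1 \<le> v; 0 \<le> x; 0 \<le> y; v * c = x * a + y * b\<rbrakk> \<Longrightarrow> u3 \<le> v"
  using rot.relation2_minimal[of v y x] by simp

lemma the_minimal_relations_matrix:
  "the_minimal_relations_matrix_is (vector [a, b, c])
     (vector [vector [u1, - r12, - r13], vector [- r21, u2, - r23], vector [- r31, - r32, u3]])"
    (is "the_minimal_relations_matrix_is ?d ?A")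
  unfolding the_minimal_relations_matrix_is_def
proof (intro allI iffI)
  \<comment> \<open>Membership requires multipliers of at least 2, which holds since each diagonal
    entry exceeds a positive off-diagonal one.\<close>
  have diag: "u1 \<in> relation_multiples ?d 1" "u2 \<in> relation_multiples ?d 2"
      "u3 \<in> relation_multiples ?d 3"
    unfolding relation_multiples_iff
    using relation1 relation2 relation3 pos sizes
    by (smt (verit))+
  have least: "\<And>v. v \<in> relation_multiples ?d 1 \<Longrightarrow> u1 \<le> v"
      "\<And>v. v \<in> relation_multiples ?d 2 \<Longrightarrow> u2 \<le> v"
      "\<And>v. v \<in> relation_multiples ?d 3 \<Longrightarrow> u3 \<le> v"
    unfolding relation_multiples_iff
    using relation1_minimal relation2_minimal relation3_minimal
    by (metis one_le_numeral order.trans)+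
  {
    fix B assume "B = ?A"
    have "?A *v ?d = 0"
      using relation1 relation2 relation3
      by (simp add: vec_eq_iff forall_3 matrix_vector_mult_def sum_3)
    moreover have "(GCD j\<in>UNIV. ?A $ i $ j) = 1" for i
      using row2_coprime rot.row2_coprime rot2.row2_coprime exhaust_3[of i]
      by (auto simp: UNIV_3 gcd.commute gcd.left_commute)
    ultimately have "minimal_relations_matrix ?d ?A"
      unfolding minimal_relations_matrix_def
      using diag least pos column_sums by (simp add: forall_3)
    then show "minimal_relations_matrix ?d B" using \<open>B = ?A\<close> by simp
  }
  fix B assume "minimal_relations_matrix ?d B"
  then have rel: "B *v ?d = 0" and off: "\<And>i j. i \<noteq> j \<Longrightarrow> B $ i $ j \<le> 0"
    and mem: "\<And>i. B $ i $ i \<in> relation_multiples ?d i"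
    and le: "\<And>i v. v \<in> relation_multiples ?d i \<Longrightarrow> B $ i $ i \<le> v"
    unfolding minimal_relations_matrix_def by auto
  \<comment> \<open>Both diagonals consist of least elements of the same sets. Once they agree,
    uniqueness of the relation in each row fixes the remaining entries.\<close>
  have B: "B $ 1 $ 1 = u1" "B $ 2 $ 2 = u2" "B $ 3 $ 3 = u3"
    using diag least mem le by (meson order.antisym)+
  have rows: "u1 * a + B $ 1 $ 2 * b + B $ 1 $ 3 * c = 0"
    "B $ 2 $ 1 * a + u2 * b + B $ 2 $ 3 * c = 0"
    "B $ 3 $ 1 * a + B $ 3 $ 2 * b + u3 * c = 0"
    using rel by (simp_all add: vec_eq_iff forall_3 matrix_vector_mult_def sum_3 B)
  have "- B $ 1 $ 3 = r13 \<and> - B $ 1 $ 2 = r12"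
    using rows(1) off[of 1 2] off[of 1 3] by (intro rot2.relation2_unique) auto
  moreover have "- B $ 2 $ 1 = r21 \<and> - B $ 2 $ 3 = r23"
    using rows(2) off[of 2 1] off[of 2 3] by (intro relation2_unique) auto
  moreover have "- B $ 3 $ 2 = r32 \<and> - B $ 3 $ 1 = r31"
    using rows(3) off[of 3 1] off[of 3 2] by (intro rot.relation2_unique) auto
  ultimately show "B = ?A"
    by (auto simp: vec_eq_iff forall_3 B)
qed

end

section \<open>Consecutive cubes and the nine odd residue classes modulo 18\<close>

lemma three_relations_cubes:
  fixes n :: int
  assumes "0 < r12" "0 < r13" "0 < r21" "0 < r23" "0 < r31" "0 < r32"
    and "u1 = r21 + r31" "u2 = r12 + r32" "u3 = r13 + r23"
    and "(n - 1) ^ 3 = u2 * u3 - r23 * r32" "n ^ 3 = u1 * u3 - r13 * r31"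
      "(n + 1) ^ 3 = u1 * u2 - r12 * r21"
  shows "three_relations ((n - 1) ^ 3) (n ^ 3) ((n + 1) ^ 3) u1 u2 u3 r12 r13 r21 r23 r31 r32"
proof
  \<comment> \<open>Two consecutive cubes are coprime already, and the inner gcd divides
    \<open>n ^ 3\<close>.\<close>
  have "coprime (n - 1) n" using coprime_diff_one_left[of n] by simp
  then have "coprime ((n - 1) ^ 3) (gcd (n ^ 3) ((n + 1) ^ 3))"
    by (meson coprime_divisors coprime_power_left_iff coprime_power_right_iff dvd_refl gcd_dvd1 zero_less_numeral)
  then show "gcd ((n - 1) ^ 3) (gcd (n ^ 3) ((n + 1) ^ 3)) = 1"
    by (rule coprime_imp_gcd_eq_1)
qed (use assms in auto)

context
  fixes n u1 u2 u3 r12 r13 r21 r23 r31 r32 :: int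
  assumes rel: "three_relations ((n - 1) ^ 3) (n ^ 3) ((n + 1) ^ 3) u1 u2 u3 r12 r13 r21 r23 r31 r32"
begin

interpretation three_relations "(n - 1) ^ 3" "n ^ 3" "(n + 1) ^ 3" u1 u2 u3 r12 r13 r21 r23 r31 r32
  by (rule rel)

lemma cubes_matrix:
  "the_minimal_relations_matrix_is (cube_generators n)
     (vector [vector [u1, - r12, - r13], vector [- r21, u2, - r23], vector [- r31, - r32, u3]])"
  using the_minimal_relations_matrix unfolding cube_generators_def .

text \<open>The value enters through an equation, doubled to avoid division, so each class leaves
  only a polynomial identity in \<open>m\<close>.\<close>

lemma cubes_genus:
  assumes "2 * g = 1 + (u1 - 1) * (n - 1) ^ 3 + (u2 - 1) * n ^ 3 + (u3 - 1) * (n + 1) ^ 3 - u1 * u2 * u3"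
  shows "int (genus (gen_semigroup (cube_generators n))) = g"
  using assms genus_S unfolding cube_generators_def S_eq_gen_semigroup by simp

lemma cubes_frobenius_if_le:
  assumes "r32 * n ^ 3 \<le> r23 * (n + 1) ^ 3"
    and "f = (r12 - 1) * n ^ 3 + (u3 - 1) * (n + 1) ^ 3 - (n - 1) ^ 3"
  shows "frobenius_number (gen_semigroup (cube_generators n)) = f"
  using assms frobenius_S_if_le(1) unfolding cube_generators_def S_eq_gen_semigroup by simp

lemma cubes_frobenius_if_ge:
  assumes "r23 * (n + 1) ^ 3 \<le> r32 * n ^ 3"
    and "f = (u2 - 1) * n ^ 3 + (r13 - 1) * (n + 1) ^ 3 - (n - 1) ^ 3"
  shows "frobenius_number (gen_semigroup (cube_generators n)) = f"
  using assms frobenius_S_if_le(2) unfolding cube_generators_def S_eq_gen_semigroup by simp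

end

text \<open>In every class \<open>r32 = 8\<close>, so \<open>8 \<le> r23\<close> makes the corner
  \<open>(r12 - 1, u3 - 1)\<close> the decisive one.\<close>

lemma eight_cubes_le:
  fixes n k :: int
  assumes "0 \<le> n" "8 \<le> k"
  shows "8 * n ^ 3 \<le> k * (n + 1) ^ 3"
  using assms by (intro mult_mono power_mono) auto

text \<open>The third row is uniform in \<open>n\<close>: from
  \<open>(n - 1)^3 + 8 n^3 = (3 n - 1) (3 n^2 + 1)\<close> and
  \<open>(n + 1)^3 - (n - 1)^3 = 2 (3 n^2 + 1)\<close> one gets \<open>u3 = (3 n - 1) / 2\<close>,
  an integer for odd \<open>n\<close>, with \<open>r31 = u3 + 1\<close> and \<open>r32 = 8\<close>.
  The other rows depend on the class modulo 18.\<close>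

theorem mainTheorem6:
  fixes n :: int
  assumes "n \<ge> 5" and "odd n"
  shows
    "(\<forall>m\<ge>1. n = 18 * m + 1 \<longrightarrow>
         the_minimal_relations_matrix_is (cube_generators n)
          (vector [
            vector [216 * m^2 + 29 * m + 1, - (216 * m^2 - 8 * m), - m],
            vector [- (216 * m^2 + 2 * m - 1), 216 * m^2 - 8 * m + 8, - (26 * m + 1)],
            vector [- (27 * m + 2), - 8, 27 * m + 1]]) \<and>
         int (genus (gen_semigroup (cube_generators n))) = 629856 * m^5 + 160380 * m^4 + 23220 * m^3 + 2330 * m^2 + 73 * m \<and>
         frobenius_number (gen_semigroup (cube_generators n)) = 1259712 * m^5 + 320760 * m^4 + 44712 * m^3 + 4644 * m^2 + 154 * m - 1) \<and>
     (\<forall>m\<ge>1. n = 18 * m + 3 \<longrightarrow>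
         the_minimal_relations_matrix_is (cube_generators n)
          (vector [
            vector [216 * m^2 + 83 * m + 8, - (216 * m^2 + 40 * m), - (7 * m + 1)],
            vector [- (216 * m^2 + 56 * m + 3), 216 * m^2 + 40 * m + 8, - (20 * m + 3)],
            vector [- (27 * m + 5), - 8, 27 * m + 4]]) \<and>
         int (genus (gen_semigroup (cube_generators n))) = 629856 * m^5 + 510300 * m^4 + 172260 * m^3 + 30134 * m^2 + 2657 * m + 91 \<and>
         frobenius_number (gen_semigroup (cube_generators n)) = 1259712 * m^5 + 1020600 * m^4 + 332424 * m^3 + 55404 * m^2 + 4698 * m + 157) \<and>
     (\<forall>m\<ge>0. n = 18 * m + 5 \<longrightarrow>
         the_minimal_relations_matrix_is (cube_generators n)
          (vector [
            vector [216 * m^2 + 128 * m + 19, - (216 * m^2 + 88 * m + 8), - (4 * m + 1)],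
            vector [- (216 * m^2 + 101 * m + 11), 216 * m^2 + 88 * m + 16, - (23 * m + 6)],
            vector [- (27 * m + 8), - 8, 27 * m + 7]]) \<and>
         int (genus (gen_semigroup (cube_generators n))) = 629856 * m^5 + 860220 * m^4 + 476820 * m^3 + 134186 * m^2 + 19121 * m + 1098 \<and>
         frobenius_number (gen_semigroup (cube_generators n)) = 1259712 * m^5 + 1720440 * m^4 + 946728 * m^3 + 263412 * m^2 + 37082 * m + 2107) \<and>
     (\<forall>m\<ge>0. n = 18 * m + 7 \<longrightarrow>
         the_minimal_relations_matrix_is (cube_generators n)
          (vector [
            vector [216 * m^2 + 191 * m + 42, - (216 * m^2 + 136 * m + 16), - (19 * m + 7)],
            vector [- (216 * m^2 + 164 * m + 31), 216 * m^2 + 136 * m + 24, - (8 * m + 3)],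
            vector [- (27 * m + 11), - 8, 27 * m + 10]]) \<and>
         int (genus (gen_semigroup (cube_generators n))) = 629856 * m^5 + 1210140 * m^4 + 936900 * m^3 + 365246 * m^2 + 71609 * m + 5637 \<and>
         (m = 0 \<longrightarrow> frobenius_number (gen_semigroup (cube_generators n)) = 10745) \<and>
         (m \<ge> 1 \<longrightarrow> frobenius_number (gen_semigroup (cube_generators n)) = 1259712 * m^5 + 2420280 * m^4 + 1840968 * m^3 + 693468 * m^2 + 129322 * m + 9537)) \<and>
     (\<forall>m\<ge>0. n = 18 * m + 9 \<longrightarrow>
         the_minimal_relations_matrix_is (cube_generators n)
          (vector [
            vector [216 * m^2 + 245 * m + 69, - (216 * m^2 + 184 * m + 32), - (25 * m + 12)],
            vector [- (216 * m^2 + 218 * m + 55), 216 * m^2 + 184 * m + 40, - (2 * m + 1)],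
            vector [- (27 * m + 14), - 8, 27 * m + 13]]) \<and>
         int (genus (gen_semigroup (cube_generators n))) = 629856 * m^5 + 1560060 * m^4 + 1552500 * m^3 + 776234 * m^2 + 195001 * m + 19684 \<and>
         (m \<le> 3 \<longrightarrow> frobenius_number (gen_semigroup (cube_generators n)) = 1259712 * m^5 + 3108456 * m^4 + 3083184 * m^3 + 1537596 * m^2 + 385666 * m + 38919) \<and>
         (m \<ge> 4 \<longrightarrow> frobenius_number (gen_semigroup (cube_generators n)) = 1259712 * m^5 + 3120120 * m^4 + 3061800 * m^3 + 1488132 * m^2 + 358074 * m + 34087)) \<and>
     (\<forall>m\<ge>0. n = 18 * m + 11 \<longrightarrow>
         the_minimal_relations_matrix_is (cube_generators n)
          (vector [
            vector [216 * m^2 + 290 * m + 97, - (216 * m^2 + 232 * m + 56), - (22 * m + 13)],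
            vector [- (216 * m^2 + 263 * m + 80), 216 * m^2 + 232 * m + 64, - (5 * m + 3)],
            vector [- (27 * m + 17), - 8, 27 * m + 16]]) \<and>
         int (genus (gen_semigroup (cube_generators n))) = 629856 * m^5 + 1909980 * m^4 + 2323620 * m^3 + 1417694 * m^2 + 433745 * m + 53223 \<and>
         (m = 0 \<longrightarrow> frobenius_number (gen_semigroup (cube_generators n)) = 103589) \<and>
         (m \<ge> 1 \<longrightarrow> frobenius_number (gen_semigroup (cube_generators n)) = 1259712 * m^5 + 3819960 * m^4 + 4609224 * m^3 + 2766636 * m^2 + 826058 * m + 98125)) \<and>
     (\<forall>m\<ge>0. n = 18 * m + 13 \<longrightarrow>
         the_minimal_relations_matrix_is (cube_generators n)
          (vector [
            vector [216 * m^2 + 326 * m + 123, - (216 * m^2 + 280 * m + 88), - (10 * m + 7)],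
            vector [- (216 * m^2 + 299 * m + 103), 216 * m^2 + 280 * m + 96, - (17 * m + 12)],
            vector [- (27 * m + 20), - 8, 27 * m + 19]]) \<and>
         int (genus (gen_semigroup (cube_generators n))) = 629856 * m^5 + 2259900 * m^4 + 3250260 * m^3 + 2342114 * m^2 + 845465 * m + 122286 \<and>
         frobenius_number (gen_semigroup (cube_generators n)) = 1259712 * m^5 + 4519800 * m^4 + 6483240 * m^3 + 4648212 * m^2 + 1665946 * m + 238803) \<and>
     (\<forall>m\<ge>0. n = 18 * m + 15 \<longrightarrow>
         the_minimal_relations_matrix_is (cube_generators n)
          (vector [
            vector [216 * m^2 + 380 * m + 167, - (216 * m^2 + 328 * m + 120), - (16 * m + 13)],
            vector [- (216 * m^2 + 353 * m + 144), 216 * m^2 + 328 * m + 128, - (11 * m + 9)],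
            vector [- (27 * m + 23), - 8, 27 * m + 22]]) \<and>
         int (genus (gen_semigroup (cube_generators n))) = 629856 * m^5 + 2609820 * m^4 + 4332420 * m^3 + 3601550 * m^2 + 1499153 * m + 249937 \<and>
         frobenius_number (gen_semigroup (cube_generators n)) = 1259712 * m^5 + 5219640 * m^4 + 8637192 * m^3 + 7135452 * m^2 + 2943162 * m + 484897) \<and>
     (\<forall>m\<ge>0. n = 18 * m + 17 \<longrightarrow>
         the_minimal_relations_matrix_is (cube_generators n)
          (vector [
            vector [216 * m^2 + 425 * m + 209, - (216 * m^2 + 376 * m + 160), - (13 * m + 12)],
            vector [- (216 * m^2 + 398 * m + 183), 216 * m^2 + 376 * m + 168, - (14 * m + 13)],
            vector [- (27 * m + 26), - 8, 27 * m + 25]]) \<and>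
         int (genus (gen_semigroup (cube_generators n))) = 629856 * m^5 + 2959740 * m^4 + 5570100 * m^3 + 5247626 * m^2 + 2474713 * m + 467304 \<and>
         frobenius_number (gen_semigroup (cube_generators n)) = 1259712 * m^5 + 5919480 * m^4 + 11117736 * m^3 + 10433124 * m^2 + 4892186 * m + 917039)"
proof ((intro conjI; intro allI impI), goal_cases)
  case (1 m)
  let ?n = "18 * m + 1"
  \<comment> \<open>Linear arithmetic treats \<open>m ^ 2\<close> as an atom; this bound yields
    positivity of entries such as \<open>216 * m^2 - 8 * m\<close>.\<close>
  have "m \<le> m ^ 2" using 1(1) by (cases "m = 0") (auto simp: power2_eq_square)
  then have rel: "three_relations ((?n - 1) ^ 3) (?n ^ 3) ((?n + 1) ^ 3)
      (216 * m^2 + 29 * m + 1) (216 * m^2 - 8 * m + 8) (27 * m + 1)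
      (216 * m^2 - 8 * m) m (216 * m^2 + 2 * m - 1)
      (26 * m + 1) (27 * m + 2) 8"
    by (intro three_relations_cubes) (use 1(1) in \<open>(linarith | algebra)+\<close>)
  have le: "8 * ?n ^ 3 \<le> (26 * m + 1) * (?n + 1) ^ 3"
    using eight_cubes_le[of ?n "26 * m + 1"] 1(1) by simp
  show ?case
    unfolding 1(2)
    by (intro conjI cubes_matrix[OF rel] cubes_genus[OF rel] cubes_frobenius_if_le[OF rel le])
      algebra+
next
  case (2 m)
  let ?n = "18 * m + 3"
  have "m \<le> m ^ 2" using 2(1) by (cases "m = 0") (auto simp: power2_eq_square)
  then have rel: "three_relations ((?n - 1) ^ 3) (?n ^ 3) ((?n + 1) ^ 3)
      (216 * m^2 + 83 * m + 8) (216 * m^2 + 40 * m + 8) (27 * m + 4)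
      (216 * m^2 + 40 * m) (7 * m + 1) (216 * m^2 + 56 * m + 3)
      (20 * m + 3) (27 * m + 5) 8"
    by (intro three_relations_cubes) (use 2(1) in \<open>(linarith | algebra)+\<close>)
  have le: "8 * ?n ^ 3 \<le> (20 * m + 3) * (?n + 1) ^ 3"
    using eight_cubes_le[of ?n "20 * m + 3"] 2(1) by simp
  show ?case
    unfolding 2(2)
    by (intro conjI cubes_matrix[OF rel] cubes_genus[OF rel] cubes_frobenius_if_le[OF rel le])
      algebra+
next
  \<comment> \<open>For \<open>m = 0\<close> the genus is
    \<open>(1 + 18 * 64 + 15 * 125 + 6 * 216 - 19 * 16 * 7) / 2 = 1098\<close>, the constant term
    proved here. The English statement ends in \<open>18993 m + 1066\<close> instead of
    \<open>19121 m + 1098\<close>.\<close>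
  case (3 m)
  let ?n = "18 * m + 5"
  have "m \<le> m ^ 2" using 3(1) by (cases "m = 0") (auto simp: power2_eq_square)
  then have rel: "three_relations ((?n - 1) ^ 3) (?n ^ 3) ((?n + 1) ^ 3)
      (216 * m^2 + 128 * m + 19) (216 * m^2 + 88 * m + 16) (27 * m + 7)
      (216 * m^2 + 88 * m + 8) (4 * m + 1) (216 * m^2 + 101 * m + 11)
      (23 * m + 6) (27 * m + 8) 8"
    by (intro three_relations_cubes) (use 3(1) in \<open>(linarith | algebra)+\<close>)
  have le: "8 * ?n ^ 3 \<le> (23 * m + 6) * (?n + 1) ^ 3"
  \<comment> \<open>At \<open>m = 0\<close> the entry \<open>r23 = 6\<close> is below 8, but
    \<open>8 * 5^3 = 1000\<close> is still less than \<open>6 * 6^3 = 1296\<close>.\<close>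
  proof (cases "m = 0")
    case False
    then show ?thesis using eight_cubes_le[of ?n "23 * m + 6"] 3(1) by simp
  qed simp
  show ?case
    unfolding 3(2)
    by (intro conjI cubes_matrix[OF rel] cubes_genus[OF rel] cubes_frobenius_if_le[OF rel le])
      algebra+
next
  case (4 m)
  let ?n = "18 * m + 7"
  have "m \<le> m ^ 2" using 4(1) by (cases "m = 0") (auto simp: power2_eq_square)
  then have rel: "three_relations ((?n - 1) ^ 3) (?n ^ 3) ((?n + 1) ^ 3)
      (216 * m^2 + 191 * m + 42) (216 * m^2 + 136 * m + 24) (27 * m + 10)
      (216 * m^2 + 136 * m + 16) (19 * m + 7) (216 * m^2 + 164 * m + 31)
      (8 * m + 3) (27 * m + 11) 8"
    by (intro three_relations_cubes) (use 4(1) in \<open>(linarith | algebra)+\<close>)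
  \<comment> \<open>Here \<open>r23 = 3\<close> and \<open>n = 7\<close>, so the other corner wins,
    which accounts for the exceptional value 10745.\<close>
  have small: "(8 * m + 3) * (?n + 1) ^ 3 \<le> 8 * ?n ^ 3" if "m = 0"
    using that by simp
  have large: "8 * ?n ^ 3 \<le> (8 * m + 3) * (?n + 1) ^ 3" if "m \<ge> 1"
    using that eight_cubes_le[of ?n "8 * m + 3"] 4(1) by simp
  show ?case
    unfolding 4(2)
    by (intro conjI impI cubes_matrix[OF rel] cubes_genus[OF rel]
        cubes_frobenius_if_ge[OF rel small] cubes_frobenius_if_le[OF rel large])
      (assumption | simp; fail | algebra)+
next
  case (5 m)
  let ?n = "18 * m + 9"
  have "m \<le> m ^ 2" using 5(1) by (cases "m = 0") (auto simp: power2_eq_square)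
  then have rel: "three_relations ((?n - 1) ^ 3) (?n ^ 3) ((?n + 1) ^ 3)
      (216 * m^2 + 245 * m + 69) (216 * m^2 + 184 * m + 40) (27 * m + 13)
      (216 * m^2 + 184 * m + 32) (25 * m + 12) (216 * m^2 + 218 * m + 55)
      (2 * m + 1) (27 * m + 14) 8"
    by (intro three_relations_cubes) (use 5(1) in \<open>(linarith | algebra)+\<close>)
  \<comment> \<open>For \<open>m \<le> 3\<close> the entry \<open>r23 = 2 * m + 1\<close> is at most
    7; the four inequalities are checked one by one.\<close>
  have small: "(2 * m + 1) * (?n + 1) ^ 3 \<le> 8 * ?n ^ 3" if "m \<le> 3"
  proof -
    have "m = 0 \<or> m = 1 \<or> m = 2 \<or> m = 3" using that 5(1) by linarith
    then show ?thesis by auto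
  qed
  have large: "8 * ?n ^ 3 \<le> (2 * m + 1) * (?n + 1) ^ 3" if "m \<ge> 4"
    using that eight_cubes_le[of ?n "2 * m + 1"] 5(1) by simp
  show ?case
    unfolding 5(2)
    by (intro conjI impI cubes_matrix[OF rel] cubes_genus[OF rel]
        cubes_frobenius_if_ge[OF rel small] cubes_frobenius_if_le[OF rel large])
      (assumption | simp; fail | algebra)+
next
  case (6 m)
  let ?n = "18 * m + 11"
  have "m \<le> m ^ 2" using 6(1) by (cases "m = 0") (auto simp: power2_eq_square)
  then have rel: "three_relations ((?n - 1) ^ 3) (?n ^ 3) ((?n + 1) ^ 3)
      (216 * m^2 + 290 * m + 97) (216 * m^2 + 232 * m + 64) (27 * m + 16)
      (216 * m^2 + 232 * m + 56) (22 * m + 13) (216 * m^2 + 263 * m + 80)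
      (5 * m + 3) (27 * m + 17) 8"
    by (intro three_relations_cubes) (use 6(1) in \<open>(linarith | algebra)+\<close>)
  have small: "(5 * m + 3) * (?n + 1) ^ 3 \<le> 8 * ?n ^ 3" if "m = 0"
    using that by simp
  \<comment> \<open>At \<open>m = 1\<close> the bound is met exactly, with
    \<open>r23 = 8\<close>.\<close>
  have large: "8 * ?n ^ 3 \<le> (5 * m + 3) * (?n + 1) ^ 3" if "m \<ge> 1"
    using that eight_cubes_le[of ?n "5 * m + 3"] 6(1) by simp
  show ?case
    unfolding 6(2)
    by (intro conjI impI cubes_matrix[OF rel] cubes_genus[OF rel]
        cubes_frobenius_if_ge[OF rel small] cubes_frobenius_if_le[OF rel large])
      (assumption | simp; fail | algebra)+
next
  \<comment> \<open>The Frobenius polynomial proved here is the value at the corner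
    \<open>(r12 - 1, u3 - 1)\<close>. The English statement repeats the one for
    \<open>n = 18 m + 9\<close>, whose value 34087 at \<open>m = 0\<close> lies below the genus
    122286.\<close>
  case (7 m)
  let ?n = "18 * m + 13"
  have "m \<le> m ^ 2" using 7(1) by (cases "m = 0") (auto simp: power2_eq_square)
  then have rel: "three_relations ((?n - 1) ^ 3) (?n ^ 3) ((?n + 1) ^ 3)
      (216 * m^2 + 326 * m + 123) (216 * m^2 + 280 * m + 96) (27 * m + 19)
      (216 * m^2 + 280 * m + 88) (10 * m + 7) (216 * m^2 + 299 * m + 103)
      (17 * m + 12) (27 * m + 20) 8"
    by (intro three_relations_cubes) (use 7(1) in \<open>(linarith | algebra)+\<close>)
  have le: "8 * ?n ^ 3 \<le> (17 * m + 12) * (?n + 1) ^ 3"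
    using eight_cubes_le[of ?n "17 * m + 12"] 7(1) by simp
  show ?case
    unfolding 7(2)
    by (intro conjI cubes_matrix[OF rel] cubes_genus[OF rel] cubes_frobenius_if_le[OF rel le])
      algebra+
next
  case (8 m)
  let ?n = "18 * m + 15"
  have "m \<le> m ^ 2" using 8(1) by (cases "m = 0") (auto simp: power2_eq_square)
  then have rel: "three_relations ((?n - 1) ^ 3) (?n ^ 3) ((?n + 1) ^ 3)
      (216 * m^2 + 380 * m + 167) (216 * m^2 + 328 * m + 128) (27 * m + 22)
      (216 * m^2 + 328 * m + 120) (16 * m + 13) (216 * m^2 + 353 * m + 144)
      (11 * m + 9) (27 * m + 23) 8"
    by (intro three_relations_cubes) (use 8(1) in \<open>(linarith | algebra)+\<close>)
  have le: "8 * ?n ^ 3 \<le> (11 * m + 9) * (?n + 1) ^ 3"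
    using eight_cubes_le[of ?n "11 * m + 9"] 8(1) by simp
  show ?case
    unfolding 8(2)
    by (intro conjI cubes_matrix[OF rel] cubes_genus[OF rel] cubes_frobenius_if_le[OF rel le])
      algebra+
next
  case (9 m)
  let ?n = "18 * m + 17"
  have "m \<le> m ^ 2" using 9(1) by (cases "m = 0") (auto simp: power2_eq_square)
  then have rel: "three_relations ((?n - 1) ^ 3) (?n ^ 3) ((?n + 1) ^ 3)
      (216 * m^2 + 425 * m + 209) (216 * m^2 + 376 * m + 168) (27 * m + 25)
      (216 * m^2 + 376 * m + 160) (13 * m + 12) (216 * m^2 + 398 * m + 183)
      (14 * m + 13) (27 * m + 26) 8"
    by (intro three_relations_cubes) (use 9(1) in \<open>(linarith | algebra)+\<close>)
  have le: "8 * ?n ^ 3 \<le> (14 * m + 13) * (?n + 1) ^ 3"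
    using eight_cubes_le[of ?n "14 * m + 13"] 9(1) by simp
  show ?case
    unfolding 9(2)
    by (intro conjI cubes_matrix[OF rel] cubes_genus[OF rel] cubes_frobenius_if_le[OF rel le])
      algebra+
qed

end
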